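(* Let $\mathcal{C}_2$ be the two-dimensional comb, with initial rotor configuration $\rho_0$ given by $$\rho_0(x,y)=\begin{cases}(x,y+1), & y>0,\\ (x,y-1), & y<0,\\ (x+1,0), & y=0,\ x\ge 0,\\ (x-1,0), & y=0,\ x<0,\end{cases}$$ and with clockwise rotor sequence at every vertex. Let $R_n$ be the rotor-router cluster of $n$ particles on $\mathcal{C}_2$ started at $o=(0,0)$ with these data. Let $h(x)=\left\lfloor \frac{(x+1)^2}{3}\right\rfloor$ for $x\in\mathbb{N}_0$, and for integers $m\ge 0$ let $$B_m=\{(x,y)\in\mathcal{C}_2:\ |x|\le m,\ |y|\le h(m-|x|)\}.$$ Then for all $m\ge 0$, with $n_m=|B_m|$, the rotor-router cluster satisfies $R_{n_m}=B_m$.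
   Context: $\mathbb{N}_0=\{0,1,2,\dots\}$. The two-dimensional comb $\mathcal{C}_2$ is the graph with vertex set $\mathbb{Z}^2$ obtained from the square lattice $\mathbb{Z}^2$ by removing all horizontal edges except those on the $x$-axis. Thus $(x,y)\sim(x,y\pm1)$ for all $(x,y)$, and $(x,0)\sim(x\pm1,0)$. The root is $o=(0,0)$. A rotor configuration assigns to each vertex one of its neighbours (the rotor at that vertex). Each vertex $z$ has a fixed cyclic ordering of its neighbours. Clockwise rotor sequence means that the rotor moves clockwise in the plane: for a vertex on the $x$-axis the cyclic order is right, down, left, up, right, ...; for a vertex off the $x$-axis the rotor alternates between up and down. Rotor-router walk: at each step the rotor at the particle's current position is first advanced to the next neighbour in the cyclic order, and then the particle moves to the neighbour the rotor now points at. Rotor-router aggregation: $R_1=\{o\}$, and for $n\ge1$, $R_{n+1}=R_n\cup\{z_n\}$, where $z_n$ is the first vertex outside $R_n$ visited by a rotor-router walk started at $o$. The rotor configuration starts as $\rho_0$ and is not reset when a new particle is started at $o$. The set $R_n$ is called the rotor-router cluster of $n$ particles. *)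

theory Defs
  imports Complex_Main
begin

section \<open>Rotor-router walk and aggregation\<close>

text \<open>
  A rotor mechanism is given by \<open>nxt\<close>, where \<open>nxt z w\<close> is the successor of the
  neighbour \<open>w\<close> of \<open>z\<close> in the cyclic ordering of the neighbours of \<open>z\<close>.
  The values \<open>nxt z w\<close> for \<open>w\<close> not a neighbour of \<open>z\<close> are irrelevant.
\<close>

definition cyclic_neighbour_order ::
    "('v \<Rightarrow> 'v \<Rightarrow> bool) \<Rightarrow> ('v \<Rightarrow> 'v \<Rightarrow> 'v) \<Rightarrow> bool" where
  "cyclic_neighbour_order adj nxt \<longleftrightarrow>
     (\<forall>z w. adj z w \<longrightarrow> {u. adj z u} = range (\<lambda>k. (nxt z ^^ k) w))"

text \<open>States are pairs of a rotor configuration and the position of the particle.\<close>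

definition rotor_step ::
    "('v \<Rightarrow> 'v \<Rightarrow> 'v) \<Rightarrow> ('v \<Rightarrow> 'v) \<times> 'v \<Rightarrow> ('v \<Rightarrow> 'v) \<times> 'v" where
  "rotor_step nxt = (\<lambda>(\<rho>, z). let w = nxt z (\<rho> z) in (\<rho>(z := w), w))"

definition rotor_walk ::
    "('v \<Rightarrow> 'v \<Rightarrow> 'v) \<Rightarrow> ('v \<Rightarrow> 'v) \<Rightarrow> 'v \<Rightarrow> nat \<Rightarrow> ('v \<Rightarrow> 'v) \<times> 'v" where
  "rotor_walk nxt \<rho> z t = (rotor_step nxt ^^ t) (\<rho>, z)"

text \<open>The step at which the walk first visits a vertex outside \<open>R\<close> (unspecified if there is none;
  on an infinite connected locally finite graph, a finite \<open>R\<close> is always left).\<close>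

definition exit_time ::
    "('v \<Rightarrow> 'v \<Rightarrow> 'v) \<Rightarrow> ('v \<Rightarrow> 'v) \<Rightarrow> 'v \<Rightarrow> 'v set \<Rightarrow> nat" where
  "exit_time nxt \<rho> z R = (LEAST t. snd (rotor_walk nxt \<rho> z t) \<notin> R)"

text \<open>
  The cluster together with the current rotor configuration. The recursion starts
  with the empty cluster: the first particle leaves it at time \<open>0\<close>, hence settles at
  the origin without moving any rotor (\<open>aggregation_1\<close> below).
\<close>

primrec aggregation ::
    "('v \<Rightarrow> 'v \<Rightarrow> 'v) \<Rightarrow> ('v \<Rightarrow> 'v) \<Rightarrow> 'v \<Rightarrow> nat \<Rightarrow> 'v set \<times> ('v \<Rightarrow> 'v)" where
  "aggregation nxt \<rho>\<^sub>0 orig 0 = ({}, \<rho>\<^sub>0)"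
| "aggregation nxt \<rho>\<^sub>0 orig (Suc n) =
     (let (R, \<rho>) = aggregation nxt \<rho>\<^sub>0 orig n;
          (\<rho>', z) = rotor_walk nxt \<rho> orig (exit_time nxt \<rho> orig R)
      in (insert z R, \<rho>'))"

definition rotor_cluster ::
    "('v \<Rightarrow> 'v \<Rightarrow> 'v) \<Rightarrow> ('v \<Rightarrow> 'v) \<Rightarrow> 'v \<Rightarrow> nat \<Rightarrow> 'v set" where
  "rotor_cluster nxt \<rho>\<^sub>0 orig n = fst (aggregation nxt \<rho>\<^sub>0 orig n)"

lemma aggregation_1: "aggregation nxt \<rho>\<^sub>0 orig 1 = ({orig}, \<rho>\<^sub>0)"
  by (simp add: exit_time_def rotor_walk_def)

lemma rotor_cluster_1: "rotor_cluster nxt \<rho>\<^sub>0 orig 1 = {orig}"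
  unfolding rotor_cluster_def aggregation_1 by simp

section \<open>The two-dimensional comb\<close>

type_synonym vertex = "int \<times> int"

definition comb_adj :: "vertex \<Rightarrow> vertex \<Rightarrow> bool" where
  "comb_adj = (\<lambda>(x, y) (x', y').
     (x' = x \<and> \<bar>y' - y\<bar> = 1) \<or> (y = 0 \<and> y' = 0 \<and> \<bar>x' - x\<bar> = 1))"

text \<open>On the axis: right, down, left, up, right.\<close>

definition comb_clockwise :: "vertex \<Rightarrow> vertex \<Rightarrow> vertex" where
  "comb_clockwise = (\<lambda>(x, y) w.
     if y = 0 then
       (if w = (x + 1, 0) then (x, -1)
        else if w = (x, -1) then (x - 1, 0)
        else if w = (x - 1, 0) then (x, 1)
        else (x + 1, 0))
     else
       (if w = (x, y + 1) then (x, y - 1) else (x, y + 1)))"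

definition comb_rho0 :: "vertex \<Rightarrow> vertex" where
  "comb_rho0 = (\<lambda>(x, y).
     if y > 0 then (x, y + 1)
     else if y < 0 then (x, y - 1)
     else if x \<ge> 0 then (x + 1, 0)
     else (x - 1, 0))"

definition comb_height :: "nat \<Rightarrow> int" where
  "comb_height x = \<lfloor>(real x + 1)\<^sup>2 / 3\<rfloor>"

definition comb_B :: "nat \<Rightarrow> vertex set" where
  "comb_B m = {(x, y). \<bar>x\<bar> \<le> int m \<and> \<bar>y\<bar> \<le> comb_height (m - nat \<bar>x\<bar>)}"

lemma comb_rho0_adj: "comb_adj z (comb_rho0 z)"
  by (auto simp: comb_adj_def comb_rho0_def split: prod.splits)

lemma comb_nbrs:
  "{u. comb_adj (x, y) u} =
     (if y = 0 then {(x + 1, 0), (x, -1), (x - 1, 0), (x, 1)} else {(x, y + 1), (x, y - 1)})"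
  by (auto simp: comb_adj_def)

lemma comb_clockwise_cyclic: "cyclic_neighbour_order comb_adj comb_clockwise"
  unfolding cyclic_neighbour_order_def
proof (intro allI impI)
  fix z w assume adj: "comb_adj z w"
  obtain x y where z: "z = (x, y)" by (cases z)
  let ?f = "comb_clockwise z"
  have closed: "comb_adj z (?f u)" for u
    by (auto simp: comb_adj_def comb_clockwise_def z)
  have "comb_adj z ((?f ^^ k) w)" for k
    by (induction k) (simp_all add: adj closed)
  then have "range (\<lambda>k. (?f ^^ k) w) \<subseteq> {u. comb_adj z u}" by auto
  moreover have "{u. comb_adj z u} \<subseteq> (\<lambda>k. (?f ^^ k) w) ` {0, 1, 2, 3}"
  proof -
    have w: "w \<in> {u. comb_adj (x, y) u}" using adj z by simp
    show ?thesis
    proof (cases "y = 0")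
      case True
      then show ?thesis
        using w unfolding z comb_nbrs
        by (auto simp: comb_clockwise_def numeral_eq_Suc)
    next
      case False
      then show ?thesis
        using w unfolding z comb_nbrs
        by (auto simp: comb_clockwise_def numeral_eq_Suc)
    qed
  qed
  ultimately show "{u. comb_adj z u} = range (\<lambda>k. (?f ^^ k) w)" by blast
qed

lemma finite_comb_B: "finite (comb_B m)"
proof -
  have "comb_B m \<subseteq> (\<Union>x\<in>{- int m..int m}.
      {x} \<times> {- comb_height (m - nat \<bar>x\<bar>)..comb_height (m - nat \<bar>x\<bar>)})"
    by (auto simp: comb_B_def)
  then show ?thesis by (rule finite_subset) auto
qed

end

theory Submission
  imports Defs
begin

text \<open>
  The proof never follows an individual particle. It guesses the odometer, the function
  counting how often a particle leaves each vertex while \<open>card (comb_B m)\<close> particles aggregate,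
  and then shows that the guess is right. Two properties of a guess \<open>u\<close> suffice. The first is
  balance: if the rotor at every \<open>z\<close> is advanced \<open>u z\<close> times, then the particles started
  at the origin end up with exactly one on each vertex of \<open>B\<close>, the set in question. The
  second is acyclicity: the rotors reached in this way contain no cycle inside the support of
  \<open>u\<close>.

  Balance bounds the actual odometer \<open>U\<close> by \<open>u\<close> at all times. A vertex \<open>z\<close> is left only while
  it carries two particles, the settled one and the walking one. If \<open>U z\<close> had already reached
  \<open>u z\<close> while \<open>U \<le> u\<close> elsewhere, then \<open>z\<close> would have received at most as many particles as under
  \<open>u\<close>, hence would carry at most one. The same bound shows that every walk leaves the cluster.
  Acyclicity turns \<open>U \<le> u\<close> into equality: on the finite set \<open>A\<close> where \<open>U < u\<close>, the remaining
  exits do not decrease the number of particles, because each vertex of \<open>A\<close> ends with one; but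
  some last exit leaves \<open>A\<close>, and nothing enters \<open>A\<close> from outside. So \<open>A\<close> is empty.

  On the comb the odometer is found from the tips inwards, since the comb is a tree and the net
  flow over an edge has to be the number of vertices of \<open>B\<close> beyond it. Write \<open>k = m - \<bar>x\<bar>\<close>.
  Vertex \<open>(x, 0)\<close> is left \<open>4 * flow k\<close> times, \<open>flow k\<close> times in each direction, where the increments
  of \<open>flow\<close> are the sizes of the outer parts of \<open>B\<close>. In a tooth of height \<open>h\<close>, the acyclic
  solutions are determined by the number \<open>e\<close> of rotors at the bottom of the tooth that point back
  to the axis, and the axis vertex sends exactly \<open>h * (h + 1) / 2 + e\<close> particles into the tooth, with
  \<open>0 \<le> e \<le> h\<close>. So everything depends on the inequalities
  \<open>triangle (height k) \<le> flow k < triangle (height k + 1)\<close>, and this is what singles out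
  \<open>(k + 1)\<^sup>2 div 3\<close> as the height. They are checked by closed forms in each residue class
  of \<open>k\<close> modulo \<open>3\<close>.

  The pattern has one irregularity: an axis vertex with \<open>k = 2\<close> is left \<open>23\<close> rather than \<open>24\<close> times.
  This respects the symmetry of the comb, unless that vertex is the origin, so \<open>m = 2\<close> has an
  odometer of its own.
\<close>

section \<open>The least action principle\<close>

definition exit_to :: "('v \<Rightarrow> 'v \<Rightarrow> 'v) \<Rightarrow> ('v \<Rightarrow> 'v) \<Rightarrow> 'v \<Rightarrow> nat \<Rightarrow> 'v" where
  "exit_to nxt \<rho>\<^sub>0 z k = (nxt z ^^ k) (\<rho>\<^sub>0 z)"

definition sent :: "('v \<Rightarrow> 'v \<Rightarrow> 'v) \<Rightarrow> ('v \<Rightarrow> 'v) \<Rightarrow> 'v \<Rightarrow> 'v \<Rightarrow> nat \<Rightarrow> nat" where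
  "sent nxt \<rho>\<^sub>0 z w k = card {j \<in> {1..k}. exit_to nxt \<rho>\<^sub>0 z j = w}"

lemma exit_to_Suc: "exit_to nxt \<rho>\<^sub>0 z (Suc k) = nxt z (exit_to nxt \<rho>\<^sub>0 z k)"
  by (simp add: exit_to_def)

lemma sent_0: "sent nxt \<rho>\<^sub>0 z w 0 = 0"
  by (simp add: sent_def)

lemma sent_Suc:
  "sent nxt \<rho>\<^sub>0 z w (Suc k) = sent nxt \<rho>\<^sub>0 z w k + of_bool (exit_to nxt \<rho>\<^sub>0 z (Suc k) = w)"
proof -
  have "{j \<in> {1..Suc k}. exit_to nxt \<rho>\<^sub>0 z j = w} =
      {j \<in> {1..k}. exit_to nxt \<rho>\<^sub>0 z j = w} \<union> (if exit_to nxt \<rho>\<^sub>0 z (Suc k) = w then {Suc k} else {})"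
    by (auto simp: le_Suc_eq)
  then show ?thesis by (simp add: sent_def)
qed

lemma sent_mono: "k \<le> l \<Longrightarrow> sent nxt \<rho>\<^sub>0 z w k \<le> sent nxt \<rho>\<^sub>0 z w l"
  unfolding sent_def by (rule card_mono) auto

text \<open>
  Each exit reaches at most one vertex of \<open>A\<close>. In this form the bound compares the exits
  that two odometers assign to one vertex.
\<close>

lemma sum_sent_le:
  assumes "finite A" "k \<le> l"
  shows "(\<Sum>w\<in>A. sent nxt \<rho>\<^sub>0 z w l) + k \<le> (\<Sum>w\<in>A. sent nxt \<rho>\<^sub>0 z w k) + l"
  using \<open>k \<le> l\<close>
proof (induction l rule: dec_induct)
  case (step l)
  have "(\<Sum>w\<in>A. of_bool (exit_to nxt \<rho>\<^sub>0 z (Suc l) = w) :: nat) \<le> 1"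
    using assms(1) by (simp add: of_bool_def)
  with step.IH show ?case
    by (simp add: sent_Suc sum.distrib)
qed simp

lemma sum_sent_less:
  assumes "finite A" "k < l" "exit_to nxt \<rho>\<^sub>0 z l \<notin> A"
  shows "(\<Sum>w\<in>A. sent nxt \<rho>\<^sub>0 z w l) + k < (\<Sum>w\<in>A. sent nxt \<rho>\<^sub>0 z w k) + l"
proof -
  obtain l' where l: "l = Suc l'" using assms(2) by (cases l) auto
  have "(\<Sum>w\<in>A. of_bool (exit_to nxt \<rho>\<^sub>0 z l = w) :: nat) = 0"
    using assms(3) by (intro sum.neutral) auto
  then show ?thesis
    using sum_sent_le[OF assms(1), of k l' nxt \<rho>\<^sub>0 z] assms(2) by (simp add: l sent_Suc sum.distrib)
qed

text \<open>
  The assumption \<open>rank\<close> expresses acyclicity: the rank grows along every final rotor in the support,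
  so a vertex of maximal rank in a finite subset of the support has its final rotor pointing out of
  that subset.
\<close>

locale acyclic_odometer =
  fixes nxt :: "'v \<Rightarrow> 'v \<Rightarrow> 'v" and \<rho>\<^sub>0 :: "'v \<Rightarrow> 'v" and orig :: 'v
    and B :: "'v set" and u :: "'v \<Rightarrow> nat" and N :: nat and rank :: "'v \<Rightarrow> int"
  assumes finite_B: "finite B"
    and support: "u z > 0 \<Longrightarrow> z \<in> B"
    and balance: "N * of_bool (w = orig) + (\<Sum>z\<in>B. sent nxt \<rho>\<^sub>0 z w (u z)) = u w + of_bool (w \<in> B)"
    and rank: "u z > 0 \<Longrightarrow> rank z < rank (exit_to nxt \<rho>\<^sub>0 z (u z))"
begin

text \<open>
  Both invariants say that the particle count at each vertex, computed from the exits \<open>U\<close> made so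
  far, agrees with the actual positions of the particles. In \<open>settled\<close> all \<open>n\<close> particles rest on
  \<open>R\<close>; in \<open>in_flight\<close> the last one is still walking, and may stand on an occupied vertex.
\<close>

definition settled :: "nat \<Rightarrow> 'v set \<Rightarrow> ('v \<Rightarrow> 'v) \<Rightarrow> ('v \<Rightarrow> nat) \<Rightarrow> bool" where
  "settled n R \<rho> U \<longleftrightarrow> \<rho> = (\<lambda>z. exit_to nxt \<rho>\<^sub>0 z (U z)) \<and> U \<le> u \<and>
     (\<forall>w. n * of_bool (w = orig) + (\<Sum>z\<in>B. sent nxt \<rho>\<^sub>0 z w (U z)) = U w + of_bool (w \<in> R))"

definition in_flight :: "nat \<Rightarrow> 'v set \<Rightarrow> ('v \<Rightarrow> 'v) \<times> 'v \<Rightarrow> ('v \<Rightarrow> nat) \<Rightarrow> bool" where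
  "in_flight n R s U \<longleftrightarrow> fst s = (\<lambda>z. exit_to nxt \<rho>\<^sub>0 z (U z)) \<and> U \<le> u \<and>
     (\<forall>w. n * of_bool (w = orig) + (\<Sum>z\<in>B. sent nxt \<rho>\<^sub>0 z w (U z))
        = U w + of_bool (w \<in> R) + of_bool (w = snd s))"

text \<open>
  A vertex that has used up its quota \<open>u z\<close> carries at most one particle, because its neighbours have
  sent at most what they send under \<open>u\<close>. An occupied vertex visited by the walk carries two, so it
  can still be left without exceeding \<open>u\<close>.
\<close>

lemma in_flight_step:
  assumes "in_flight n R (\<rho>, z) U" "n \<le> N" "z \<in> R"
  shows "in_flight n R (rotor_step nxt (\<rho>, z)) (U(z := Suc (U z)))" and "z \<in> B"
proof -
  have \<rho>: "\<rho> = (\<lambda>v. exit_to nxt \<rho>\<^sub>0 v (U v))" and le: "U \<le> u"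
    and bal: "\<And>w. n * of_bool (w = orig) + (\<Sum>v\<in>B. sent nxt \<rho>\<^sub>0 v w (U v))
      = U w + of_bool (w \<in> R) + of_bool (w = z)"
    using assms(1) by (auto simp: in_flight_def)
  have "U z < u z"
  proof (rule ccontr)
    assume "\<not> U z < u z"
    then have eq: "U z = u z" using le by (simp add: le_fun_def le_antisym linorder_not_less)
    have "u z + 2 = n * of_bool (z = orig) + (\<Sum>v\<in>B. sent nxt \<rho>\<^sub>0 v z (U v))"
      using bal[of z] \<open>z \<in> R\<close> eq by simp
    also have "\<dots> \<le> N * of_bool (z = orig) + (\<Sum>v\<in>B. sent nxt \<rho>\<^sub>0 v z (u v))"
      using le \<open>n \<le> N\<close> by (intro add_mono sum_mono mult_right_mono sent_mono) (auto simp: le_fun_def)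
    also have "\<dots> \<le> u z + 1" by (simp add: balance)
    finally show False by simp
  qed
  then show "z \<in> B" using support[of z] by simp
  let ?U = "U(z := Suc (U z))"
  let ?w' = "exit_to nxt \<rho>\<^sub>0 z (Suc (U z))"
  have sum: "(\<Sum>v\<in>B. sent nxt \<rho>\<^sub>0 v w (?U v)) = (\<Sum>v\<in>B. sent nxt \<rho>\<^sub>0 v w (U v)) + of_bool (w = ?w')" for w
  proof -
    have "(\<Sum>v\<in>B. sent nxt \<rho>\<^sub>0 v w (?U v)) =
        (\<Sum>v\<in>B. sent nxt \<rho>\<^sub>0 v w (U v) + (if v = z then of_bool (w = ?w') else 0))"
      by (intro sum.cong) (auto simp: sent_Suc)
    then show ?thesis using finite_B \<open>z \<in> B\<close> by (simp add: sum.distrib)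
  qed
  have step: "rotor_step nxt (\<rho>, z) = (\<rho>(z := ?w'), ?w')"
    by (simp add: rotor_step_def Let_def exit_to_Suc \<rho>)
  show "in_flight n R (rotor_step nxt (\<rho>, z)) ?U"
    unfolding in_flight_def step fst_conv snd_conv
  proof (intro conjI allI)
    show "\<rho>(z := ?w') = (\<lambda>v. exit_to nxt \<rho>\<^sub>0 v (?U v))" by (auto simp: \<rho>)
    show "?U \<le> u" using le \<open>U z < u z\<close> by (auto simp: le_fun_def)
    show "n * of_bool (w = orig) + (\<Sum>v\<in>B. sent nxt \<rho>\<^sub>0 v w (?U v))
        = ?U w + of_bool (w \<in> R) + of_bool (w = ?w')" for w
      unfolding sum using bal[of w] by auto
  qed
qed

lemma in_flight_walk:
  assumes "in_flight n R (\<rho>, orig) U" "n \<le> N"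
    and "\<And>s. s < t \<Longrightarrow> snd (rotor_walk nxt \<rho> orig s) \<in> R"
  shows "\<exists>V. in_flight n R (rotor_walk nxt \<rho> orig t) V \<and> sum V B = sum U B + t"
  using assms(3)
proof (induction t)
  case 0
  then show ?case using assms(1) by (auto simp: rotor_walk_def)
next
  case (Suc t)
  then obtain V where V: "in_flight n R (rotor_walk nxt \<rho> orig t) V" "sum V B = sum U B + t"
    by auto
  obtain \<rho>' z where walk: "rotor_walk nxt \<rho> orig t = (\<rho>', z)" by fastforce
  have "z \<in> R" using Suc.prems[of t] walk by simp
  note step = in_flight_step[OF V(1)[unfolded walk] assms(2) this]
  have "sum (V(z := Suc (V z))) B = (\<Sum>v\<in>B. V v + (if v = z then 1 else 0))"
    by (intro sum.cong) auto
  also have "\<dots> = sum V B + 1"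
    using finite_B step(2) by (simp add: sum.distrib)
  finally have "sum (V(z := Suc (V z))) B = sum U B + Suc t" using V(2) by simp
  moreover have "rotor_walk nxt \<rho> orig (Suc t) = rotor_step nxt (\<rho>', z)"
    using walk by (simp add: rotor_walk_def)
  ultimately show ?case using step(1) by metis
qed

text \<open>
  Every step inside \<open>R\<close> raises the total of \<open>U\<close>, which is bounded by the total of \<open>u\<close>.
\<close>

lemma exit_exists:
  assumes "in_flight n R (\<rho>, orig) U" "n \<le> N"
  shows "\<exists>t. snd (rotor_walk nxt \<rho> orig t) \<notin> R"
proof (rule ccontr)
  assume "\<nexists>t. snd (rotor_walk nxt \<rho> orig t) \<notin> R"
  then obtain V where "in_flight n R (rotor_walk nxt \<rho> orig (Suc (sum u B))) V"
      and V: "sum V B = sum U B + Suc (sum u B)"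
    using in_flight_walk[OF assms] by blast
  then have "sum V B \<le> sum u B"
    by (intro sum_mono) (auto simp: in_flight_def le_fun_def)
  then show False using V by simp
qed

lemma settled_aggregation:
  assumes "n \<le> N"
  shows "\<exists>U. settled n (fst (aggregation nxt \<rho>\<^sub>0 orig n)) (snd (aggregation nxt \<rho>\<^sub>0 orig n)) U"
  using assms
proof (induction n)
  case 0
  then show ?case
    by (intro exI[of _ "\<lambda>_. 0"]) (auto simp: settled_def exit_to_def sent_0 le_fun_def)
next
  case (Suc n)
  obtain R \<rho> where agg: "aggregation nxt \<rho>\<^sub>0 orig n = (R, \<rho>)" by fastforce
  with Suc obtain U where "settled n R \<rho> U" by auto
  then have start: "in_flight (Suc n) R (\<rho>, orig) U"
    by (auto simp: settled_def in_flight_def)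
  define t where "t = exit_time nxt \<rho> orig R"
  obtain \<rho>' z where walk: "rotor_walk nxt \<rho> orig t = (\<rho>', z)" by fastforce
  have "z \<notin> R"
    using LeastI_ex[OF exit_exists[OF start Suc.prems]] walk
    by (simp add: t_def exit_time_def)
  have inside: "snd (rotor_walk nxt \<rho> orig s) \<in> R" if "s < t" for s
    using that unfolding t_def exit_time_def by (auto dest: not_less_Least)
  from in_flight_walk[OF start Suc.prems, of t] inside walk
  obtain V where "in_flight (Suc n) R (\<rho>', z) V" by auto
  then have "settled (Suc n) (insert z R) \<rho>' V"
    using \<open>z \<notin> R\<close> by (auto simp: settled_def in_flight_def of_bool_def)
  moreover have "aggregation nxt \<rho>\<^sub>0 orig (Suc n) = (insert z R, \<rho>')"
    using agg walk by (simp add: t_def)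
  ultimately show ?case by auto
qed

text \<open>
  Once \<open>N\<close> particles have settled, \<open>U = u\<close>: the missing exits from the deficit set \<open>A\<close> would
  turn at most one particle per vertex of \<open>A\<close> into exactly one, whereas the last exit from a vertex of
  maximal rank takes a particle out of \<open>A\<close> and none comes in. Then the particle counts agree as well.
\<close>

lemma settled_eq:
  assumes "settled N R \<rho> U"
  shows "R = B"
proof -
  have le: "\<And>z. U z \<le> u z"
    and bal: "\<And>w. N * of_bool (w = orig) + (\<Sum>z\<in>B. sent nxt \<rho>\<^sub>0 z w (U z)) = U w + of_bool (w \<in> R)"
    using assms by (auto simp: settled_def le_fun_def)
  define A where "A = {z \<in> B. U z < u z}"
  have fin: "finite A" using finite_B by (simp add: A_def)
  have outside: "U z = u z" if "z \<notin> A" for z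
    using that le[of z] support[of z] by (force simp: A_def)
  have "A = {}"
  proof (rule ccontr)
    assume "A \<noteq> {}"
    then obtain z where z: "z \<in> A" "\<And>v. v \<in> A \<Longrightarrow> rank v \<le> rank z"
    proof -
      obtain z where "z \<in> A" "rank z = Max (rank ` A)"
        using Max_in[of "rank ` A"] fin \<open>A \<noteq> {}\<close> by fastforce
      then show thesis using that[of z] fin by simp
    qed
    have pos: "U z < u z" using z(1) by (simp add: A_def)
    have out: "exit_to nxt \<rho>\<^sub>0 z (u z) \<notin> A"
      using z(2) rank[of z] pos by force
    \<comment> \<open>Counted by departure: the missing exits bring fewer particles into \<open>A\<close> than leave vertices of \<open>A\<close>.\<close>
    have "(\<Sum>v\<in>A. (\<Sum>w\<in>A. sent nxt \<rho>\<^sub>0 v w (u v)) + U v) < (\<Sum>v\<in>A. (\<Sum>w\<in>A. sent nxt \<rho>\<^sub>0 v w (U v)) + u v)"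
      by (rule sum_strict_mono_ex1[OF fin])
        (use sum_sent_le[OF fin] le sum_sent_less[OF fin pos out] z(1) in auto)
    then have 1: "(\<Sum>w\<in>A. \<Sum>v\<in>A. sent nxt \<rho>\<^sub>0 v w (u v)) + sum U A < (\<Sum>w\<in>A. \<Sum>v\<in>A. sent nxt \<rho>\<^sub>0 v w (U v)) + sum u A"
      unfolding sum.distrib by (subst (1 2) sum.swap) simp
    \<comment> \<open>Counted by arrival: no vertex of \<open>A\<close> loses a particle, as it ends with exactly one.\<close>
    have 2: "(\<Sum>v\<in>A. sent nxt \<rho>\<^sub>0 v w (U v)) + u w \<le> (\<Sum>v\<in>A. sent nxt \<rho>\<^sub>0 v w (u v)) + U w" if "w \<in> A" for w
    proof -
      have AB: "A \<subseteq> B" by (auto simp: A_def)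
      have "(\<Sum>v\<in>B-A. sent nxt \<rho>\<^sub>0 v w (U v)) = (\<Sum>v\<in>B-A. sent nxt \<rho>\<^sub>0 v w (u v))"
        by (intro sum.cong) (auto simp: outside)
      then show ?thesis
        using balance[of w] bal[of w] that AB
          sum.subset_diff[OF AB finite_B, of "\<lambda>v. sent nxt \<rho>\<^sub>0 v w (u v)"]
          sum.subset_diff[OF AB finite_B, of "\<lambda>v. sent nxt \<rho>\<^sub>0 v w (U v)"]
        by (auto simp: of_bool_def split: if_splits)
    qed
    have "(\<Sum>w\<in>A. (\<Sum>v\<in>A. sent nxt \<rho>\<^sub>0 v w (U v)) + u w)
        \<le> (\<Sum>w\<in>A. (\<Sum>v\<in>A. sent nxt \<rho>\<^sub>0 v w (u v)) + U w)"
      by (rule sum_mono) (rule 2)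
    then show False using 1 by (simp add: sum.distrib)
  qed
  then have "U = u" using outside by auto
  have "w \<in> R \<longleftrightarrow> w \<in> B" for w
    using balance[of w] bal[of w] unfolding \<open>U = u\<close> by (simp add: of_bool_def split: if_splits)
  then show ?thesis by auto
qed

lemma cluster_eq: "rotor_cluster nxt \<rho>\<^sub>0 orig N = B"
  using settled_aggregation[of N] settled_eq unfolding rotor_cluster_def by blast

end

section \<open>Tooth heights and the flow along the axis\<close>

definition height :: "nat \<Rightarrow> nat" where
  "height k = (k + 1)\<^sup>2 div 3"

lemma comb_height_eq: "comb_height k = int (height k)"
proof -
  have "\<lfloor>(real k + 1)\<^sup>2 / 3\<rfloor> = \<lfloor>real ((k + 1)\<^sup>2) / real 3\<rfloor>" by (simp add: add.commute)
  also have "\<dots> = int ((k + 1)\<^sup>2 div 3)" by (rule floor_divide_of_nat_eq)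
  finally show ?thesis by (simp add: comb_height_def height_def)
qed

lemma height_mod3:
  "height (3 * j) = 3 * j\<^sup>2 + 2 * j"
  "height (3 * j + 1) = 3 * j\<^sup>2 + 4 * j + 1"
  "height (3 * j + 2) = 3 * j\<^sup>2 + 6 * j + 3"
proof -
  have squares: "(3 * j + 1)\<^sup>2 = 3 * (3 * j\<^sup>2 + 2 * j) + 1"
    "(3 * j + 1 + 1)\<^sup>2 = 3 * (3 * j\<^sup>2 + 4 * j + 1) + 1"
    "(3 * j + 2 + 1)\<^sup>2 = 3 * (3 * j\<^sup>2 + 6 * j + 3)"
    by (simp_all only: power2_eq_square distrib_left distrib_right mult_1_left mult_1_right)
  have div3: "(3 * n + 1) div 3 = n" "(3 * n) div 3 = n" for n :: nat by simp_all
  show "height (3 * j) = 3 * j\<^sup>2 + 2 * j" by (simp only: height_def squares div3)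
  show "height (3 * j + 1) = 3 * j\<^sup>2 + 4 * j + 1" by (simp only: height_def squares div3)
  show "height (3 * j + 2) = 3 * j\<^sup>2 + 6 * j + 3" by (simp only: height_def squares div3)
qed

lemma height_small: "height 0 = 0" "height (Suc 0) = 1" "height (Suc (Suc 0)) = 3"
  using height_mod3[of 0] by (simp_all add: numeral_2_eq_2)

text \<open>
  The part of \<open>comb_B m\<close> with \<open>x \<ge> m - k\<close>, for \<open>k < m\<close>: it is supplied entirely through the axis edge
  that enters column \<open>m - k\<close> from the origin's side.
\<close>

definition wing :: "nat \<Rightarrow> nat" where
  "wing k = (\<Sum>i\<le>k. 2 * height i + 1)"

text \<open>
  How often an axis vertex at distance \<open>k\<close> from the tip sends a particle into its tooth, in either
  direction, and towards the origin. Outwards it sends equally many, except one fewer for \<open>k = 2\<close>: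
  there the increment \<open>wing 1\<close> alone would give \<open>flow 2 = 5\<close>, but a tooth of height \<open>3\<close> cannot be
  filled with fewer than \<open>6\<close> particles entering it. The summand \<open>of_bool (k = 1)\<close> accounts for this.
\<close>

primrec flow :: "nat \<Rightarrow> nat" where
  "flow 0 = 0"
| "flow (Suc k) = flow k + wing k + of_bool (k = 1)"

declare flow.simps [simp del]

definition triangle :: "nat \<Rightarrow> nat" where
  "triangle t = (\<Sum>i\<le>t. i)"

lemma double_triangle: "2 * triangle t = t * (t + 1)"
  unfolding triangle_def by (induction t) auto

lemma triangle_Suc: "triangle (Suc t) = triangle t + Suc t"
  by (simp add: triangle_def)

lemma wing_Suc: "wing (Suc k) = wing k + 2 * height (Suc k) + 1"
  by (simp add: wing_def)

lemma flow_2: "flow 2 = 6"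
  by (simp add: flow.simps wing_def height_small numeral_2_eq_2)

text \<open>
  The closed forms are polynomials in each residue class modulo \<open>3\<close>. One class suffices, with
  \<open>k \<equiv> 2\<close> chosen because it starts at \<open>k = 2\<close>, after which the recursion for \<open>flow\<close> is regular.
\<close>

lemma wing_flow_mod3_aux:
  "wing (3 * j + 2) = 6 * j ^ 3 + 21 * j\<^sup>2 + 26 * j + 11 \<and>
   2 * flow (3 * j + 2) = 9 * j ^ 4 + 36 * j ^ 3 + 58 * j\<^sup>2 + 41 * j + 12"
proof (induction j)
  case 0
  have "wing 2 = 11" by (simp add: wing_def height_small numeral_2_eq_2)
  then show ?case using flow_2 by (simp add: numeral_2_eq_2)
next
  case (Suc j)
  have h: "height (3 * j + 3) = 3 * j\<^sup>2 + 8 * j + 5" "height (3 * j + 4) = 3 * j\<^sup>2 + 10 * j + 8"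
    "height (3 * j + 5) = 3 * j\<^sup>2 + 12 * j + 12"
    using height_mod3[of "j + 1"] by (simp_all add: power2_eq_square algebra_simps)
  have sucs: "3 * j + 3 = Suc (3 * j + 2)" "3 * j + 4 = Suc (3 * j + 3)" "3 * j + 5 = Suc (3 * j + 4)"
    by simp_all
  have w: "wing (3 * j + 3) = wing (3 * j + 2) + 2 * height (3 * j + 3) + 1"
    "wing (3 * j + 4) = wing (3 * j + 3) + 2 * height (3 * j + 4) + 1"
    "wing (3 * j + 5) = wing (3 * j + 4) + 2 * height (3 * j + 5) + 1"
    unfolding sucs wing_Suc by (rule refl)+
  have f: "flow (3 * j + 3) = flow (3 * j + 2) + wing (3 * j + 2)"
    "flow (3 * j + 4) = flow (3 * j + 3) + wing (3 * j + 3)"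
    "flow (3 * j + 5) = flow (3 * j + 4) + wing (3 * j + 4)"
    unfolding sucs flow.simps by simp_all
  have wing: "wing (3 * j + 2) = 6 * j ^ 3 + 21 * j\<^sup>2 + 26 * j + 11"
    and flow: "2 * flow (3 * j + 2) = 9 * j ^ 4 + 36 * j ^ 3 + 58 * j\<^sup>2 + 41 * j + 12"
    using Suc.IH by simp_all
  have "2 * flow (3 * j + 5) = 2 * flow (3 * j + 2) + 6 * wing (3 * j + 2)
      + 8 * height (3 * j + 3) + 4 * height (3 * j + 4) + 6"
    unfolding f w by simp
  also have "\<dots> = 9 * j ^ 4 + 72 * j ^ 3 + 220 * j\<^sup>2 + 301 * j + 156"
    unfolding flow wing h by simp
  finally have flow': "2 * flow (3 * j + 5) = 9 * j ^ 4 + 72 * j ^ 3 + 220 * j\<^sup>2 + 301 * j + 156" .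
  have wing': "wing (3 * j + 5) = 6 * j ^ 3 + 39 * j\<^sup>2 + 86 * j + 64"
    unfolding w wing h by simp
  have powers: "Suc j ^ 4 = j ^ 4 + 4 * j ^ 3 + 6 * j\<^sup>2 + 4 * j + 1"
      "Suc j ^ 3 = j ^ 3 + 3 * j\<^sup>2 + 3 * j + 1" "(Suc j)\<^sup>2 = j\<^sup>2 + 2 * j + 1"
    by (simp_all add: power2_eq_square power3_eq_cube power4_eq_xxxx algebra_simps)
  have arg: "3 * Suc j + 2 = 3 * j + 5" by simp
  show ?case unfolding arg flow' wing' powers by simp
qed

lemmas wing_flow_mod3 = wing_flow_mod3_aux[THEN conjunct1] wing_flow_mod3_aux[THEN conjunct2]

text \<open>
  For the given \<open>flow k\<close>, only one height of the tooth allows its excess to lie between \<open>0\<close> and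
  the height itself, and this is \<open>height k\<close>. The comparison is delicate: as polynomials in each residue
  class, \<open>flow k\<close> and \<open>triangle (height k)\<close> agree in their quartic and cubic terms.
\<close>

lemma flow_bounds: "triangle (height k) \<le> flow k" "flow k < triangle (Suc (height k))"
proof -
  have "triangle (height k) \<le> flow k \<and> flow k \<le> triangle (height k) + height k"
  proof (cases "k < 2")
    case True
    then consider "k = 0" | "k = 1" by linarith
    then show ?thesis by cases (simp_all add: flow.simps height_small wing_def triangle_def)
  next
    case False
    define j where "j = (k - 2) div 3"
    consider "k = 3 * j + 2" | "k = 3 * j + 3" | "k = 3 * j + 4"
      using False unfolding j_def by linarith
    then have "height k * (height k + 1) \<le> 2 * flow k \<and> 2 * flow k \<le> height k * (height k + 1) + 2 * height k"
    proof cases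
      case 1
      have h: "height k = 3 * j\<^sup>2 + 6 * j + 3" unfolding 1 by (rule height_mod3)
      have hh: "height k * (height k + 1) = 9 * j ^ 4 + 36 * j ^ 3 + 57 * j\<^sup>2 + 42 * j + 12"
        unfolding h by (simp add: power2_eq_square power3_eq_cube power4_eq_xxxx algebra_simps)
      have f: "2 * flow k = 9 * j ^ 4 + 36 * j ^ 3 + 58 * j\<^sup>2 + 41 * j + 12"
        unfolding 1 by (rule wing_flow_mod3)
      have "j \<le> j\<^sup>2" by (simp add: power2_eq_square)
      then show ?thesis unfolding f hh unfolding h by simp
    next
      case 2
      then have "k = Suc (3 * j + 2)" by simp
      then have "2 * flow k = 2 * flow (3 * j + 2) + 2 * wing (3 * j + 2)" by (simp add: flow.simps)
      also have "\<dots> = 9 * j ^ 4 + 48 * j ^ 3 + 100 * j\<^sup>2 + 93 * j + 34"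
        unfolding wing_flow_mod3 by simp
      finally have f: "2 * flow k = 9 * j ^ 4 + 48 * j ^ 3 + 100 * j\<^sup>2 + 93 * j + 34" .
      have h: "height k = 3 * j\<^sup>2 + 8 * j + 5"
        using height_mod3(1)[of "j + 1"] 2 by (simp add: power2_eq_square algebra_simps)
      have hh: "height k * (height k + 1) = 9 * j ^ 4 + 48 * j ^ 3 + 97 * j\<^sup>2 + 88 * j + 30"
        unfolding h by (simp add: power2_eq_square power3_eq_cube power4_eq_xxxx algebra_simps)
      show ?thesis unfolding f hh unfolding h by simp
    next
      case 3
      have h: "height k = 3 * j\<^sup>2 + 10 * j + 8" "height (3 * j + 3) = 3 * j\<^sup>2 + 8 * j + 5"
        using height_mod3(1,2)[of "j + 1"] 3 by (simp_all add: power2_eq_square algebra_simps)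
      have k: "k = Suc (Suc (3 * j + 2))" "3 * j + 3 = Suc (3 * j + 2)" using 3 by simp_all
      have "2 * flow k = 2 * flow (3 * j + 2) + 4 * wing (3 * j + 2) + 4 * height (3 * j + 3) + 2"
        unfolding k flow.simps wing_Suc by simp
      also have "\<dots> = 9 * j ^ 4 + 60 * j ^ 3 + 154 * j\<^sup>2 + 177 * j + 78"
        unfolding wing_flow_mod3 h by simp
      finally have f: "2 * flow k = 9 * j ^ 4 + 60 * j ^ 3 + 154 * j\<^sup>2 + 177 * j + 78" .
      have hh: "height k * (height k + 1) = 9 * j ^ 4 + 60 * j ^ 3 + 151 * j\<^sup>2 + 170 * j + 72"
        unfolding h by (simp add: power2_eq_square power3_eq_cube power4_eq_xxxx algebra_simps)
      show ?thesis unfolding f hh unfolding h by simp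
    qed
    then show ?thesis using double_triangle[of "height k"] by linarith
  qed
  then show "triangle (height k) \<le> flow k" "flow k < triangle (Suc (height k))"
    by (simp_all add: triangle_Suc)
qed

section \<open>Rotor directions on the comb\<close>

abbreviation "comb_exit \<equiv> exit_to comb_clockwise comb_rho0"
abbreviation "comb_sent \<equiv> sent comb_clockwise comb_rho0"

text \<open>
  With a rotor of period \<open>p\<close>, the offset \<open>d\<close> says how many further exits complete the period after
  an exit towards \<open>w\<close>.
\<close>

lemma sent_periodic:
  assumes "\<And>k. exit_to nxt \<rho>\<^sub>0 z k = w \<longleftrightarrow> p dvd k + d" "d < p"
  shows "sent nxt \<rho>\<^sub>0 z w k = (k + d) div p"
proof (induction k)
  case (Suc k)
  then show ?case by (simp add: sent_Suc assms(1) div_Suc dvd_eq_mod_eq_0)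
qed (use assms(2) in \<open>simp add: sent_0\<close>)

text \<open>
  The direction of the initial rotor on the axis. Expressed through it, the left and the right half
  of the axis follow one rule, because a half turn of the plane preserves the clockwise order.
\<close>

definition away :: "int \<Rightarrow> int" where
  "away x = (if x \<ge> 0 then 1 else -1)"

lemma comb_exit_axis:
  "comb_exit (x, 0) k =
    (if 4 dvd k then (x + away x, 0) else if 4 dvd k + 3 then (x, - away x)
     else if 4 dvd k + 2 then (x - away x, 0) else (x, away x))"
proof (induction k)
  case 0
  show ?case by (simp add: exit_to_def comb_rho0_def away_def)
next
  case (Suc k)
  have clockwise:
    "comb_clockwise (x, 0) (x + away x, 0) = (x, - away x)"
    "comb_clockwise (x, 0) (x, - away x) = (x - away x, 0)"
    "comb_clockwise (x, 0) (x - away x, 0) = (x, away x)"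
    "comb_clockwise (x, 0) (x, away x) = (x + away x, 0)"
    by (simp_all add: comb_clockwise_def away_def)
  have "4 dvd k \<and> \<not> 4 dvd Suc k \<and> 4 dvd Suc k + 3
    \<or> \<not> 4 dvd k \<and> 4 dvd k + 3 \<and> \<not> 4 dvd Suc k \<and> \<not> 4 dvd Suc k + 3 \<and> 4 dvd Suc k + 2
    \<or> \<not> 4 dvd k \<and> \<not> 4 dvd k + 3 \<and> 4 dvd k + 2
      \<and> \<not> 4 dvd Suc k \<and> \<not> 4 dvd Suc k + 3 \<and> \<not> 4 dvd Suc k + 2
    \<or> \<not> 4 dvd k \<and> \<not> 4 dvd k + 3 \<and> \<not> 4 dvd k + 2 \<and> 4 dvd Suc k"
    by presburger
  then show ?case
    by (elim disjE conjE) (simp_all only: exit_to_Suc Suc.IH clockwise if_True if_False simp_thms)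
qed

lemma comb_exit_tooth:
  assumes "y \<noteq> 0"
  shows "comb_exit (x, y) k = (x, if even k then y + sgn y else y - sgn y)"
proof (induction k)
  case 0
  show ?case using assms by (simp add: exit_to_def comb_rho0_def sgn_if)
next
  case (Suc k)
  then show ?case using assms by (simp add: exit_to_Suc comb_clockwise_def sgn_if)
qed

lemma comb_sent_axis:
  "comb_sent (x, 0) (x + away x, 0) k = k div 4"
  "comb_sent (x, 0) (x, - away x) k = (k + 3) div 4"
  "comb_sent (x, 0) (x - away x, 0) k = (k + 2) div 4"
  "comb_sent (x, 0) (x, away x) k = (k + 1) div 4"
proof -
  have away: "away x \<noteq> 0" "- away x \<noteq> away x" by (auto simp: away_def)
  have "comb_sent (x, 0) (x + away x, 0) k = (k + 0) div 4"
    by (rule sent_periodic) (use away in \<open>auto simp: comb_exit_axis\<close>)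
  then show "comb_sent (x, 0) (x + away x, 0) k = k div 4" by simp
  show "comb_sent (x, 0) (x, - away x) k = (k + 3) div 4"
    by (rule sent_periodic) (use away in \<open>auto simp: comb_exit_axis, presburger+\<close>)
  show "comb_sent (x, 0) (x - away x, 0) k = (k + 2) div 4"
    by (rule sent_periodic) (use away in \<open>auto simp: comb_exit_axis, presburger+\<close>)
  show "comb_sent (x, 0) (x, away x) k = (k + 1) div 4"
    by (rule sent_periodic) (use away in \<open>auto simp: comb_exit_axis, presburger+\<close>)
qed

lemma comb_sent_tooth:
  assumes "y \<noteq> 0"
  shows "comb_sent (x, y) (x, y + sgn y) k = k div 2"
    and "comb_sent (x, y) (x, y - sgn y) k = (k + 1) div 2"
proof -
  have sgn: "sgn y \<noteq> 0" "y - sgn y \<noteq> y + sgn y" using assms by (auto simp: sgn_if)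
  have "comb_sent (x, y) (x, y + sgn y) k = (k + 0) div 2"
    by (rule sent_periodic) (use sgn in \<open>auto simp: comb_exit_tooth[OF assms]\<close>)
  then show "comb_sent (x, y) (x, y + sgn y) k = k div 2" by simp
  show "comb_sent (x, y) (x, y - sgn y) k = (k + 1) div 2"
    by (rule sent_periodic) (use sgn in \<open>auto simp: comb_exit_tooth[OF assms]\<close>)
qed

lemma comb_adj_exit: "comb_adj z (comb_exit z k)"
proof (induction k)
  case 0
  show ?case by (simp add: exit_to_def comb_rho0_adj)
next
  case (Suc k)
  show ?case by (cases z) (auto simp: exit_to_Suc comb_adj_def comb_clockwise_def)
qed

lemma sum_comb_sent:
  assumes "finite B" "{z. u z > 0} \<subseteq> B"
  shows "(\<Sum>z\<in>B. comb_sent z w (u z)) = (\<Sum>z | comb_adj w z. comb_sent z w (u z))"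
proof (rule sum.mono_neutral_cong)
  show "finite {z. comb_adj w z}"
    by (cases w) (simp add: comb_nbrs)
  have "comb_sent z w k = 0" if "\<not> comb_adj w z" for z k
  proof -
    have "comb_exit z j \<noteq> w" for j
      using comb_adj_exit[of z j] that by (auto simp: comb_adj_def split: prod.splits)
    then show ?thesis by (simp add: sent_def)
  qed
  then show "\<And>z. z \<in> B - {z. comb_adj w z} \<Longrightarrow> comb_sent z w (u z) = 0" by simp
  show "comb_sent z w (u z) = 0" if "z \<in> {z. comb_adj w z} - B" for z
  proof -
    have "u z = 0" using that assms(2) by auto
    then show ?thesis by (simp add: sent_0)
  qed
qed (use assms(1) in auto)

lemma inflow_axis:
  assumes "finite B" "{z. u z > 0} \<subseteq> B"
  shows "(\<Sum>z\<in>B. comb_sent z (x, 0) (u z)) =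
    (u (x - 1, 0) + (if x > 0 then 0 else 2)) div 4 + (u (x + 1, 0) + (if x \<ge> -1 then 2 else 0)) div 4
    + (u (x, 1) + 1) div 2 + (u (x, -1) + 1) div 2"
proof -
  have "comb_sent (x - 1, 0) (x, 0) (u (x - 1, 0)) = (u (x - 1, 0) + (if x > 0 then 0 else 2)) div 4"
    using comb_sent_axis(1,3)[of "x - 1"] by (auto simp: away_def split: if_splits)
  moreover have "comb_sent (x + 1, 0) (x, 0) (u (x + 1, 0)) = (u (x + 1, 0) + (if x \<ge> -1 then 2 else 0)) div 4"
    using comb_sent_axis(1,3)[of "x + 1"] by (auto simp: away_def split: if_splits)
  moreover have "comb_sent (x, 1) (x, 0) (u (x, 1)) = (u (x, 1) + 1) div 2"
      "comb_sent (x, -1) (x, 0) (u (x, -1)) = (u (x, -1) + 1) div 2"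
    using comb_sent_tooth(2)[of 1 x] comb_sent_tooth(2)[of "-1" x] by simp_all
  ultimately show ?thesis by (simp add: sum_comb_sent[OF assms] comb_nbrs)
qed

lemma inflow_tooth:
  assumes "finite B" "{z. u z > 0} \<subseteq> B" "y \<noteq> 0"
  shows "(\<Sum>z\<in>B. comb_sent z (x, y) (u z)) =
    (if y = away x then (u (x, 0) + 1) div 4 else if y = - away x then (u (x, 0) + 3) div 4
     else u (x, y - sgn y) div 2) + (u (x, y + sgn y) + 1) div 2"
proof -
  have up: "comb_sent (x, y + sgn y) (x, y) k = (k + 1) div 2" for k
    using comb_sent_tooth(2)[of "y + sgn y" x k] assms(3) by (auto simp: sgn_if split: if_splits)
  have dn: "comb_sent (x, y - sgn y) (x, y) k =
    (if y = away x then (k + 1) div 4 else if y = - away x then (k + 3) div 4 else k div 2)" for k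
  proof (cases "\<bar>y\<bar> = 1")
    case True
    then have "y = away x \<or> y = - away x" "y - sgn y = 0" by (auto simp: away_def sgn_if abs_if split: if_splits)
    then show ?thesis using comb_sent_axis(2,4)[of x k] by (auto simp: away_def split: if_splits)
  next
    case False
    then have "y \<noteq> away x" "y \<noteq> - away x" "y - sgn y \<noteq> 0" "sgn (y - sgn y) = sgn y"
      using assms(3) by (auto simp: away_def sgn_if)
    then show ?thesis using comb_sent_tooth(1)[of "y - sgn y" x k] by simp
  qed
  have axis: "u (x, y - sgn y) = u (x, 0)" if "y = away x \<or> y = - away x"
    using that by (auto simp: away_def split: if_splits)
  have "{z. comb_adj (x, y) z} = {(x, y + sgn y), (x, y - sgn y)}"
    using assms(3) by (auto simp: comb_nbrs sgn_if)
  moreover have "y + sgn y \<noteq> y - sgn y"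
    using assms(3) by (simp add: sgn_if)
  ultimately have sum: "(\<Sum>z\<in>B. comb_sent z (x, y) (u z)) =
      comb_sent (x, y - sgn y) (x, y) (u (x, y - sgn y)) + (u (x, y + sgn y) + 1) div 2"
    by (simp add: sum_comb_sent[OF assms(1,2)] up)
  consider "y = away x" | "y \<noteq> away x" "y = - away x" | "y \<noteq> away x" "y \<noteq> - away x" by blast
  then show ?thesis
  proof cases
    case 1
    show ?thesis unfolding sum dn axis[OF disjI1[OF 1]] using 1 by simp
  next
    case 2
    show ?thesis unfolding sum dn axis[OF disjI2[OF 2(2)]] using 2 by simp
  next
    case 3
    then show ?thesis unfolding sum dn by simp
  qed
qed

section \<open>The odometer of the comb\<close>

text \<open>
  The number of vertices at the bottom of a tooth whose final rotors point towards the axis.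
\<close>

definition excess :: "nat \<Rightarrow> nat" where
  "excess k = flow k - triangle (height k)"

lemma flow_eq: "flow k = triangle (height k) + excess k"
  using flow_bounds(1)[of k] by (simp add: excess_def)

lemma excess_le: "excess k \<le> height k"
  using flow_bounds(2)[of k] by (simp add: flow_eq triangle_Suc)

text \<open>
  Seen from the top of the tooth, the net flow across the \<open>t\<close>-th edge is \<open>t\<close>, so without excess the
  odometer is \<open>t * (t + 1)\<close>, an even number: all final rotors point up. If a final rotor points to
  the axis, its vertex makes an additional exit towards the axis, which the vertex below has to make
  up for by an additional exit upwards. These accumulate to \<open>excess k - y\<close> additional exits upwards
  and one more towards the axis. The truncated differences add \<open>2 * (excess k - y) + 1\<close> if
  \<open>y \<le> excess k\<close>, and nothing otherwise.
\<close>

definition tooth_count :: "nat \<Rightarrow> nat \<Rightarrow> nat" where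
  "tooth_count k y = 2 * triangle (height k - y) + (excess k - y) + (Suc (excess k) - y)"

lemma tooth_count_outward: "tooth_count k y div 2 = triangle (height k - y) + (excess k - y)"
  by (cases "y \<le> excess k") (simp_all add: tooth_count_def Suc_diff_le)

lemma tooth_count_inward: "(tooth_count k y + 1) div 2 = triangle (height k - y) + (Suc (excess k) - y)"
  by (cases "y \<le> excess k") (simp_all add: tooth_count_def Suc_diff_le)

lemma even_tooth_count: "even (tooth_count k y) \<longleftrightarrow> excess k < y"
  by (cases "y \<le> excess k") (auto simp: tooth_count_def Suc_diff_le)

text \<open>
  At height \<open>0\<close> the formula is not the odometer of the axis vertex, but it still gives the right flow
  into the tooth; so the balance equation below also covers the lowest vertex of a tooth.
\<close>

lemma tooth_count_0: "tooth_count k 0 div 2 = flow k"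
  by (simp add: tooth_count_outward flow_eq)

lemma triangle_0: "triangle 0 = 0"
  by (simp add: triangle_def)

lemma tooth_count_1: "(tooth_count k 1 + 1) div 2 + height k = flow k"
proof (cases "height k")
  case 0
  then show ?thesis using excess_le[of k] by (simp add: tooth_count_inward[of k 1, simplified] flow_eq)
next
  case (Suc h)
  then show ?thesis using tooth_count_inward[of k 1] by (simp add: flow_eq triangle_Suc)
qed

lemma tooth_count_beyond: "height k < y \<Longrightarrow> tooth_count k y = 0"
  using excess_le[of k] by (simp add: tooth_count_def triangle_0)

text \<open>
  The second difference of the triangular numbers is \<open>1\<close>: the particle that stays.
\<close>

lemma tooth_balance:
  assumes "y > 0"
  shows "tooth_count k (y - 1) div 2 + (tooth_count k (y + 1) + 1) div 2
      = tooth_count k y + of_bool (y \<le> height k)"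
proof -
  have "triangle (height k - (y - 1)) + triangle (height k - (y + 1))
      = 2 * triangle (height k - y) + of_bool (y \<le> height k)"
  proof (cases "y \<le> height k")
    case True
    then obtain t where t: "height k = y + t" using le_Suc_ex by blast
    then have "height k - (y - 1) = Suc t" "height k - (y + 1) = t - 1" using assms by simp_all
    then show ?thesis using t by (cases t) (simp_all add: triangle_Suc)
  qed (simp add: triangle_0)
  moreover have "excess k - (y - 1) = Suc (excess k) - y" "Suc (excess k) - (y + 1) = excess k - y"
    using assms by simp_all
  ultimately show ?thesis unfolding tooth_count_outward tooth_count_inward
    by (simp add: tooth_count_def)
qed

definition axis_count :: "nat \<Rightarrow> nat" where
  "axis_count k = 4 * flow k - of_bool (k = 2)"

lemma axis_count_div:
  "axis_count k div 4 + of_bool (k = 2) = flow k"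
  "(axis_count k + 1) div 4 = flow k"
  "(axis_count k + 2) div 4 = flow k"
  "(axis_count k + 3) div 4 = flow k"
  by (cases "k = 2"; simp add: axis_count_def flow_2)+

definition comb_odometer :: "nat \<Rightarrow> vertex \<Rightarrow> nat" where
  "comb_odometer m = (\<lambda>(x, y).
     if \<bar>x\<bar> > int m then 0
     else if y = 0 then axis_count (m - nat \<bar>x\<bar>) else tooth_count (m - nat \<bar>x\<bar>) (nat \<bar>y\<bar>))"

text \<open>
  Final rotors lead to the axis in the lower part of a tooth, outwards along the axis (at distance
  \<open>2\<close> from the tip, into a tooth without excess), and away from the axis in the upper part of a tooth.
  The two cases put every upper part above the rest of \<open>comb_B m\<close>.
\<close>

definition comb_rank :: "nat \<Rightarrow> vertex \<Rightarrow> int" where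
  "comb_rank m = (\<lambda>(x, y).
     if \<bar>y\<bar> \<le> int (excess (m - nat \<bar>x\<bar>)) then \<bar>x\<bar> - \<bar>y\<bar> else int m + 1 + \<bar>y\<bar>)"

lemma mem_comb_B: "(x, y) \<in> comb_B m \<longleftrightarrow> \<bar>x\<bar> \<le> int m \<and> nat \<bar>y\<bar> \<le> height (m - nat \<bar>x\<bar>)"
  by (simp add: comb_B_def comb_height_eq nat_le_iff)

lemma card_comb_B: "card (comb_B m) = 2 * (\<Sum>i<m. 2 * height i + 1) + 2 * height m + 1"
proof -
  let ?c = "\<lambda>x::int. 2 * height (m - nat \<bar>x\<bar>) + 1"
  have "comb_B m = (SIGMA x:{- int m..int m}. {- int (height (m - nat \<bar>x\<bar>))..int (height (m - nat \<bar>x\<bar>))})"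
    by (auto simp: comb_B_def comb_height_eq abs_le_iff)
  then have "card (comb_B m) = (\<Sum>x\<in>{- int m..int m}. ?c x)"
    by (simp add: nat_add_distrib nat_mult_distrib)
  also have "{- int m..int m} = {- int m..-1} \<union> {0} \<union> {1..int m}" by auto
  also have "(\<Sum>x\<in>\<dots>. ?c x) = (\<Sum>x\<in>{- int m..-1}. ?c x) + ?c 0 + (\<Sum>x\<in>{1..int m}. ?c x)"
    by (subst sum.union_disjoint; simp)+
  also have "(\<Sum>x\<in>{- int m..-1}. ?c x) = (\<Sum>i<m. 2 * height i + 1)"
    by (rule sum.reindex_bij_witness[of _ "\<lambda>i. int i - int m" "\<lambda>x. nat (x + int m)"])
      (auto simp: nat_diff_distrib nat_add_distrib intro!: arg_cong[of _ _ height])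
  also have "(\<Sum>x\<in>{1..int m}. ?c x) = (\<Sum>i<m. 2 * height i + 1)"
    by (rule sum.reindex_bij_witness[of _ "\<lambda>i. int m - int i" "\<lambda>x. nat (int m - x)"])
      (auto simp: nat_diff_distrib intro!: arg_cong[of _ _ height])
  finally show ?thesis by simp
qed

lemma card_comb_B_wing: "card (comb_B (Suc m)) = 2 * wing m + 2 * height (Suc m) + 1"
  unfolding card_comb_B wing_def by (simp add: lessThan_Suc_atMost)

lemma comb_odometer_support: "{z. comb_odometer m z > 0} \<subseteq> comb_B m"
proof clarsimp
  fix x y
  assume "comb_odometer m (x, y) > 0"
  then show "(x, y) \<in> comb_B m"
    using tooth_count_beyond[of "m - nat \<bar>x\<bar>" "nat \<bar>y\<bar>"]
    by (force simp: mem_comb_B comb_odometer_def split: if_splits)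
qed

lemma comb_odometer_axis:
  "comb_odometer m (x, 0) = (if nat \<bar>x\<bar> \<le> m then axis_count (m - nat \<bar>x\<bar>) else 0)"
  by (auto simp: comb_odometer_def)

lemma comb_odometer_tooth:
  "y \<noteq> 0 \<Longrightarrow> comb_odometer m (x, y) = (if nat \<bar>x\<bar> \<le> m then tooth_count (m - nat \<bar>x\<bar>) (nat \<bar>y\<bar>) else 0)"
  by (auto simp: comb_odometer_def)

lemma tooth_inflow:
  assumes "y \<noteq> 0"
  shows "(\<Sum>z\<in>comb_B m. comb_sent z (x, y) (comb_odometer m z))
    = comb_odometer m (x, y) + of_bool ((x, y) \<in> comb_B m)"
proof (cases "nat \<bar>x\<bar> \<le> m")
  case False
  then have "\<bar>x\<bar> > int m" by linarith
  then show ?thesis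
    unfolding inflow_tooth[OF finite_comb_B comb_odometer_support assms]
    by (simp add: mem_comb_B comb_odometer_def)
next
  case True
  let ?k = "m - nat \<bar>x\<bar>" and ?n = "nat \<bar>y\<bar>"
  have n: "?n > 0" "nat \<bar>y + sgn y\<bar> = ?n + 1" "nat \<bar>y - sgn y\<bar> = ?n - 1" "y + sgn y \<noteq> 0"
    using assms by (auto simp: sgn_if)
  have inner: "(if y = away x then (comb_odometer m (x, 0) + 1) div 4
      else if y = - away x then (comb_odometer m (x, 0) + 3) div 4
      else comb_odometer m (x, y - sgn y) div 2) = tooth_count ?k (?n - 1) div 2"
  proof (cases "\<bar>y\<bar> = 1")
    case True
    then have "y = away x \<or> y = - away x" by (auto simp: away_def)
    then show ?thesis
      using \<open>nat \<bar>x\<bar> \<le> m\<close> n(3) True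
      by (elim disjE) (simp_all add: comb_odometer_axis axis_count_div(2,4)[simplified] tooth_count_0)
  next
    case False
    then have "y \<noteq> away x" "y \<noteq> - away x" "y - sgn y \<noteq> 0"
      using assms by (auto simp: away_def sgn_if)
    then show ?thesis
      using \<open>nat \<bar>x\<bar> \<le> m\<close> n by (simp add: comb_odometer_tooth)
  qed
  have outer: "comb_odometer m (x, y + sgn y) = tooth_count ?k (?n + 1)"
    using True by (simp only: comb_odometer_tooth[OF n(4)] n(2) if_True)
  have own: "comb_odometer m (x, y) = tooth_count ?k ?n"
    using True by (simp only: comb_odometer_tooth[OF assms] if_True)
  have mem: "(x, y) \<in> comb_B m \<longleftrightarrow> ?n \<le> height ?k"
    using True by (simp only: mem_comb_B) linarith
  show ?thesis
    unfolding inflow_tooth[OF finite_comb_B comb_odometer_support assms] inner outer own mem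
    by (rule tooth_balance[OF n(1)])
qed

text \<open>
  The equation at axis vertices other than the origin, in terms of the distance \<open>i\<close> from the origin.
  The inner neighbour contributes its outward share, which is one less than the share in the other
  directions if it lies at distance \<open>2\<close> from the tip.
\<close>

lemma axis_balance:
  assumes "m \<noteq> 2" "i > 0"
  defines "row \<equiv> \<lambda>i. if i \<le> m then axis_count (m - i) else 0"
  shows "row (i - 1) div 4 + (row (i + 1) + 2) div 4
      + 2 * (if i \<le> m then (tooth_count (m - i) 1 + 1) div 2 else 0)
    = row i + of_bool (i \<le> m)"
proof (cases "i \<le> m")
  case False
  then show ?thesis
    by (auto simp: row_def axis_count_def flow.simps dest!: le_antisym)
next
  case True
  define k where "k = m - i"
  have le: "i - 1 \<le> m" using True by simp
  have k: "m - (i - 1) = Suc k" using True assms(2) by (simp add: k_def)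
  have teeth: "(tooth_count k 1 + 1) div 2 + height k = flow k" by (rule tooth_count_1)
  have left: "axis_count (Suc k) div 4 = flow k + wing k"
    using axis_count_div(1)[of "Suc k"] by (auto simp: flow.simps)
  have row: "row (i - 1) = axis_count (Suc k)" "row i = axis_count k"
    using True le k by (simp_all only: row_def k_def if_True)
  show ?thesis
  proof (cases k)
    case 0
    then have "row (i + 1) = 0" by (simp add: row_def k_def)
    then show ?thesis
      using True teeth left 0 unfolding row k_def[symmetric]
      by (simp add: axis_count_def flow.simps wing_def height_small)
  next
    case (Suc k')
    then have "i + 1 \<le> m" "m - (i + 1) = k'" by (simp_all add: k_def)
    then have "row (i + 1) = axis_count k'" by (simp add: row_def)
    then have right: "(row (i + 1) + 2) div 4 = flow k'" by (simp add: axis_count_div(3)[simplified])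
    have flow: "flow k = flow k' + wing k' + of_bool (k = 2)" "wing k = wing k' + 2 * height k + 1"
      by (simp_all add: Suc flow.simps wing_Suc numeral_2_eq_2)
    have "axis_count k + of_bool (k = 2) = 4 * flow k"
      by (simp add: axis_count_def flow_2)
    then show ?thesis
      using True teeth flow unfolding row k_def[symmetric] left right by simp
  qed
qed

text \<open>
  At the origin the equation determines the number of particles, and it comes out as the size of
  \<open>comb_B m\<close>. The origin's share to the left counts as inward and the one to the right as outward; they
  agree unless \<open>m = 2\<close>.
\<close>

lemma axis_inflow:
  assumes "m \<noteq> 2"
  shows "card (comb_B m) * of_bool (x = 0) + (\<Sum>z\<in>comb_B m. comb_sent z (x, 0) (comb_odometer m z))
    = comb_odometer m (x, 0) + of_bool ((x, 0) \<in> comb_B m)"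
proof -
  let ?u = "comb_odometer m" and ?i = "nat \<bar>x\<bar>"
  let ?t = "if ?i \<le> m then (tooth_count (m - ?i) 1 + 1) div 2 else 0"
  have teeth: "(?u (x, 1) + 1) div 2 = ?t" "(?u (x, -1) + 1) div 2 = ?t"
    by (simp_all add: comb_odometer_tooth)
  have mem: "(x, 0) \<in> comb_B m \<longleftrightarrow> ?i \<le> m" by (auto simp: mem_comb_B)
  note inflow = inflow_axis[OF finite_comb_B comb_odometer_support, of x m, unfolded teeth]
  show ?thesis
  proof (cases "x = 0")
    case True
    have nbrs: "?u (-1, 0) = (if m = 0 then 0 else axis_count (m - 1))"
        "?u (1, 0) = (if m = 0 then 0 else axis_count (m - 1))"
      by (auto simp: comb_odometer_axis)
    have A: "axis_count m = 4 * flow m" using assms by (simp add: axis_count_def)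
    show ?thesis
    proof (cases m)
      case 0
      then show ?thesis using inflow True nbrs tooth_count_1[of 0] unfolding mem
        by (simp add: comb_odometer_axis axis_count_def card_comb_B height_small flow.simps)
    next
      case (Suc m')
      have "flow m = flow m' + wing m'" using assms by (simp add: Suc flow.simps)
      then show ?thesis
        using inflow True nbrs Suc tooth_count_1[of m] card_comb_B_wing[of m'] axis_count_div(3)[of m'] unfolding mem
        by (simp add: comb_odometer_axis A[unfolded Suc])
    qed
  next
    case False
    then have i: "?i > 0" by simp
    have horizontal: "(?u (x - 1, 0) + (if x > 0 then 0 else 2)) div 4 + (?u (x + 1, 0) + (if x \<ge> -1 then 2 else 0)) div 4
      = (if ?i - 1 \<le> m then axis_count (m - (?i - 1)) else 0) div 4
        + ((if ?i + 1 \<le> m then axis_count (m - (?i + 1)) else 0) + 2) div 4"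
    proof -
      consider "x > 0" | "x = -1" | "x < -1" using False by linarith
      then show ?thesis
      proof cases
        case 1
        then have "nat \<bar>x - 1\<bar> = ?i - 1" "nat \<bar>x + 1\<bar> = ?i + 1" by simp_all
        with 1 show ?thesis by (simp add: comb_odometer_axis)
      next
        case 2
        have "(axis_count m + 2) div 4 = axis_count m div 4"
          using assms axis_count_div(1,3)[of m] by simp
        then show ?thesis using 2 by (simp add: comb_odometer_axis numeral_2_eq_2)
      next
        case 3
        then have "nat \<bar>x - 1\<bar> = ?i + 1" "nat \<bar>x + 1\<bar> = ?i - 1" by simp_all
        with 3 show ?thesis by (simp add: comb_odometer_axis)
      qed
    qed
    have "(\<Sum>z\<in>comb_B m. comb_sent z (x, 0) (?u z)) = ?u (x, 0) + of_bool (?i \<le> m)"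
      unfolding inflow horizontal comb_odometer_axis[of m x] axis_balance[OF assms i, symmetric]
      by (simp only: mult_2 add.assoc)
    then show ?thesis using False by (simp only: mem of_bool_eq mult_0_right add_0_left)
  qed
qed

lemma comb_rank_increases:
  assumes "comb_odometer m z > 0"
  shows "comb_rank m z < comb_rank m (comb_exit z (comb_odometer m z))"
proof -
  obtain x y where z: "z = (x, y)" by (cases z)
  define k where "k = m - nat \<bar>x\<bar>"
  have x: "\<bar>x\<bar> \<le> int m" using assms by (auto simp: z comb_odometer_def split: if_splits)
  show ?thesis
  proof (cases "y = 0")
    case True
    have u: "comb_odometer m (x, 0) = axis_count k" using x by (simp add: comb_odometer_def k_def)
    have out: "\<bar>x + away x\<bar> = \<bar>x\<bar> + 1" "\<bar>away x\<bar> = 1" by (auto simp: away_def)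
    show ?thesis
    proof (cases "k = 2")
      case False
      then have "4 dvd axis_count k" by (simp add: axis_count_def)
      then show ?thesis using True out by (simp add: z u comb_exit_axis comb_rank_def)
    next
      case k2: True
      have "\<not> 4 dvd axis_count k" "\<not> 4 dvd axis_count k + 3" "\<not> 4 dvd axis_count k + 2"
        by (simp_all add: k2 axis_count_def flow_2)
      moreover have "excess 2 = 0"
      proof -
        have "triangle 3 = 6" "height 2 = 3"
          using height_small(3) by (simp_all add: triangle_def numeral_eq_Suc)
        then show ?thesis by (simp add: excess_def flow_2)
      qed
      ultimately show ?thesis
        using True out x k2 by (simp add: z u comb_exit_axis comb_rank_def k_def)
    qed
  next
    case False
    have u: "comb_odometer m (x, y) = tooth_count k (nat \<bar>y\<bar>)"
      using False x by (simp add: comb_odometer_def k_def)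
    have y: "\<bar>y + sgn y\<bar> = \<bar>y\<bar> + 1" "\<bar>y - sgn y\<bar> = \<bar>y\<bar> - 1"
      using False by (auto simp: sgn_if)
    show ?thesis
    proof (cases "excess k < nat \<bar>y\<bar>")
      case True
      then have "even (comb_odometer m (x, y))" by (simp add: u even_tooth_count)
      moreover have "int (excess k) < \<bar>y\<bar>" using True by linarith
      ultimately show ?thesis using y False by (simp add: z comb_exit_tooth comb_rank_def k_def)
    next
      case le: False
      then have "odd (comb_odometer m (x, y))" by (simp add: u even_tooth_count)
      moreover have "\<bar>y\<bar> \<le> int (excess k)" using le by linarith
      ultimately show ?thesis using y False by (simp add: z comb_exit_tooth comb_rank_def k_def)
    qed
  qed
qed

lemma comb_odometer_acyclic:
  assumes "m \<noteq> 2"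
  shows "acyclic_odometer comb_clockwise comb_rho0 (0, 0) (comb_B m) (comb_odometer m)
    (card (comb_B m)) (comb_rank m)"
proof
  fix w :: vertex
  obtain x y where w: "w = (x, y)" by (cases w)
  show "card (comb_B m) * of_bool (w = (0, 0)) + (\<Sum>z\<in>comb_B m. comb_sent z w (comb_odometer m z))
      = comb_odometer m w + of_bool (w \<in> comb_B m)"
  proof (cases "y = 0")
    case True
    then show ?thesis using axis_inflow[OF assms] by (simp add: w)
  next
    case False
    then show ?thesis using tooth_inflow[OF False] by (simp add: w)
  qed
qed (use finite_comb_B comb_odometer_support comb_rank_increases in auto)

section \<open>The odometer for m = 2\<close>

text \<open>
  For \<open>m = 2\<close> the origin is left \<open>23\<close> times, \<open>6\<close> times to the left but only \<open>5\<close> times to the right. So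
  \<open>(-1, 0)\<close> has one particle more to handle than \<open>(1, 0)\<close>; it goes up to \<open>(-1, 1)\<close>, comes back and
  returns to the origin, which accounts for the two additional exits from \<open>(-1, 0)\<close> and the
  one from \<open>(-1, 1)\<close>.
\<close>

definition odometer2 :: "vertex \<Rightarrow> nat" where
  "odometer2 = (\<lambda>_. 0)((0, 0) := 23, (-1, 0) := 6, (1, 0) := 4, (-1, 1) := 1,
     (0, 1) := 6, (0, -1) := 6, (0, 2) := 2, (0, -2) := 2)"

text \<open>
  The final rotors lead from \<open>(-1, 1)\<close> via \<open>(-1, 0)\<close> to the origin, and away from it everywhere else.
\<close>

definition rank2 :: "vertex \<Rightarrow> int" where
  "rank2 = (\<lambda>(x, y). if x = -1 then -1 - y else \<bar>x\<bar> + \<bar>y\<bar>)"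

lemma mem_comb_B_2:
  "(x, y) \<in> comb_B 2 \<longleftrightarrow> x = 0 \<and> \<bar>y\<bar> \<le> 3 \<or> \<bar>x\<bar> = 1 \<and> \<bar>y\<bar> \<le> 1 \<or> \<bar>x\<bar> = 2 \<and> y = 0"
proof -
  have "\<bar>x\<bar> = 0 \<or> \<bar>x\<bar> = 1 \<or> \<bar>x\<bar> = 2 \<or> \<bar>x\<bar> > 2" by linarith
  then show ?thesis
    using height_small by (auto simp: mem_comb_B numeral_2_eq_2)
qed

lemma odometer2_acyclic:
  "acyclic_odometer comb_clockwise comb_rho0 (0, 0) (comb_B 2) odometer2 (card (comb_B 2)) rank2"
proof
  have support: "{z. odometer2 z > 0} \<subseteq> comb_B 2"
    by (auto simp: odometer2_def mem_comb_B_2 split: if_splits)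
  then show "odometer2 z > 0 \<Longrightarrow> z \<in> comb_B 2" for z by auto
  fix w :: vertex
  obtain x y where w: "w = (x, y)" by (cases w)
  have card: "card (comb_B 2) = 15"
    using height_small by (simp add: card_comb_B numeral_2_eq_2)
  show "card (comb_B 2) * of_bool (w = (0, 0)) + (\<Sum>z\<in>comb_B 2. comb_sent z w (odometer2 z))
      = odometer2 w + of_bool (w \<in> comb_B 2)"
  proof (cases "y = 0")
    case True
    consider "x = 0" | "x = 1" | "x = -1" | "x = 2" | "x = -2" | "x > 2" | "x < -2" by linarith
    then show ?thesis
      unfolding w True inflow_axis[OF finite_comb_B support] card mem_comb_B_2
      by cases (simp_all add: odometer2_def)
  next
    case False
    have "x = 0 \<or> x = 1 \<or> x = -1 \<or> x > 1 \<or> x < -1" by linarith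
    moreover have "y = 1 \<or> y = -1 \<or> y = 2 \<or> y = -2 \<or> y = 3 \<or> y = -3 \<or> y > 3 \<or> y < -3"
      using False by linarith
    ultimately show ?thesis
      unfolding w inflow_tooth[OF finite_comb_B support False] card mem_comb_B_2
      by (elim disjE) (simp_all add: odometer2_def away_def)
  qed
next
  fix z assume "odometer2 z > 0"
  then consider "z = (0, 0)" | "z = (-1, 0)" | "z = (1, 0)" | "z = (-1, 1)"
    | "z = (0, 1)" | "z = (0, -1)" | "z = (0, 2)" | "z = (0, -2)"
    by (auto simp: odometer2_def split: if_splits)
  then show "rank2 z < rank2 (comb_exit z (odometer2 z))"
    by cases (simp_all add: odometer2_def rank2_def comb_exit_axis comb_exit_tooth away_def)
qed (rule finite_comb_B)

section \<open>The rotor-router cluster of the comb\<close>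

theorem theorem1p1:
  fixes m :: nat
  shows "rotor_cluster comb_clockwise comb_rho0 (0, 0) (card (comb_B m)) = comb_B m"
proof (cases "m = 2")
  case True
  then show ?thesis
    using acyclic_odometer.cluster_eq[OF odometer2_acyclic] by simp
next
  case False
  then show ?thesis
    by (rule acyclic_odometer.cluster_eq[OF comb_odometer_acyclic])
qed

end
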